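(* Let $T=(V,E)$ be a tree with its leaves as boundary. Let $r$ be the inscribed radius of $T$. Suppose $|V|\geq 3$. Then $$\lambda_1(T)\ \geq\ 4\sin^2\frac{\pi}{4r+2}\ \geq\ \frac{1}{r^2}$$ if the diameter of $T$ is $2r$, and $$\lambda_1(T)\ \geq\ 4\sin^2\frac{\pi}{4r+6}\ \geq\ \frac{1}{(r+1)^2}$$ if the diameter of $T$ is $2r+1$. These bounds are sharp up to a constant factor.
   Context: Trees are finite. For a tree $T=(V,E)$ with at least three vertices, the boundary $B$ is the set of leaves (degree-one vertices) and the interior is $\Omega=V\setminus B$. The first Dirichlet eigenvalue $\lambda_1(T)=\lambda_1(T,B)$ is the smallest $\lambda$ for which there is a nonzero $f:V\to\mathbb{R}$ with $f=0$ on $B$ and $\sum_{y\sim x}(f(x)-f(y))=\lambda f(x)$ for all $x\in\Omega$. Equivalently, $\lambda_1(T)=\min \frac{\sum_{\{x,y\}\in E}(f(x)-f(y))^2}{\sum_{x\in\Omega}f(x)^2}$ over nonzero $f:V\to\mathbb{R}$ vanishing on $B$. The inscribed radius of $T$ is $r=\sup_{v\in V}\mathrm{dist}(v,B)$, i.e. the maximum over vertices of the distance to the nearest leaf. The diameter of $T$ is $\sup_{v,w\in V}\mathrm{dist}(v,w)$. *)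

theory Defs
  imports Complex_Main "Graph_Theory.Graph_Theory"
begin

text \<open>
  A finite simple graph is a \<open>pair_graph\<close>: a finite symmetric loopfree digraph without parallel
  arcs, in which an edge \<open>{x, y}\<close> is represented by the two arcs \<open>(x, y)\<close> and \<open>(y, x)\<close>.
\<close>

text \<open>
  The constant \<open>Digraph_Component.tree\<close> forbids directed cycles only: a transitive tournament
  satisfies it, and a symmetric digraph with an arc \<open>(x, y)\<close> does not, because of the directed
  cycle \<open>x, y, x\<close>. For symmetric loopfree digraphs the cycles of the underlying graph are
  the directed cycles of length at least 3.
\<close>

definition undirected_tree :: "'a pair_pre_digraph \<Rightarrow> bool" where
  "undirected_tree G \<longleftrightarrow>
     pair_graph G \<and> Digraph_Component.connected (with_proj G) \<and>
     \<not> (\<exists>p. pre_digraph.cycle (with_proj G) p \<and> length p \<ge> 3)"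

text \<open>The degree of a vertex of a symmetric digraph is its out-degree.\<close>

definition boundary :: "'a pair_pre_digraph \<Rightarrow> 'a set" where
  "boundary G = {v \<in> pverts G. out_degree (with_proj G) v = 1}"

definition interior_verts :: "'a pair_pre_digraph \<Rightarrow> 'a set" where
  "interior_verts G = pverts G - boundary G"

definition graph_dist :: "'a pair_pre_digraph \<Rightarrow> 'a \<Rightarrow> 'a \<Rightarrow> nat" where
  "graph_dist G u v = (LEAST n. \<exists>p. pre_digraph.awalk (with_proj G) u p v \<and> length p = n)"

text \<open>
  The following \<open>Min\<close> and \<open>Max\<close> range over finite nonempty sets when \<open>G\<close> is a tree with at
  least two vertices.
\<close>

definition inscribed_radius :: "'a pair_pre_digraph \<Rightarrow> nat" where
  "inscribed_radius G = Max ((\<lambda>v. Min (graph_dist G v ` boundary G)) ` pverts G)"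

definition graph_diameter :: "'a pair_pre_digraph \<Rightarrow> nat" where
  "graph_diameter G = Max ((\<lambda>(v, w). graph_dist G v w) ` (pverts G \<times> pverts G))"

definition dirichlet_eigenvalue :: "'a pair_pre_digraph \<Rightarrow> real \<Rightarrow> bool" where
  "dirichlet_eigenvalue G l \<longleftrightarrow>
     (\<exists>f :: 'a \<Rightarrow> real.
        (\<exists>x \<in> pverts G. f x \<noteq> 0) \<and>
        (\<forall>x \<in> boundary G. f x = 0) \<and>
        (\<forall>x \<in> interior_verts G. (\<Sum>y \<in> {y. (x, y) \<in> parcs G}. f x - f y) = l * f x))"

definition lambda1 :: "'a pair_pre_digraph \<Rightarrow> real" where
  "lambda1 G = (LEAST l. dirichlet_eigenvalue G l)"

end

theory Submission
  imports Defs "HOL-Analysis.Analysis"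
begin

text \<open>
  Both lower bounds hold for \<open>R = \<lceil>D / 2\<rceil>\<close>, where \<open>D\<close> is the diameter: a tree has a vertex \<open>c\<close> from
  which every vertex is at distance at most \<open>R\<close>. The function
  \<open>g x = sin (\<pi> (R - dist c x) / (2 R + 1))\<close> decreases away from \<open>c\<close>, and an interior vertex has
  exactly one neighbour closer to \<open>c\<close> (none if it is \<open>c\<close>) and at least one farther away, so \<open>g\<close>
  satisfies \<open>\<Sum>\<^bsub>y ~ x\<^esub> (g x - g y) \<ge> \<mu> g x\<close> with \<open>\<mu> = 4 sin\<^sup>2 (\<pi> / (4 R + 2))\<close>. Comparing an
  eigenfunction \<open>f\<close> with \<open>g\<close> at a maximum of \<open>\<bar>f\<bar> / g\<close> gives \<open>\<lambda>\<^sub>1 \<ge> \<mu>\<close>. Paths show sharpness.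
\<close>

section \<open>Symmetric matrices and supersolutions\<close>

text \<open>Tychonoff: the set is a product of intervals over \<open>S\<close> and of points
  \<open>{0}\<close> elsewhere, and the function type carries the product topology. The index type
  may be infinite.\<close>

lemma compact_function_box:
  fixes S :: "'i set"
  shows "compact {f :: 'i \<Rightarrow> real. (\<forall>x. x \<notin> S \<longrightarrow> f x = 0) \<and> (\<forall>x \<in> S. f x \<in> {-1..1})}"
proof -
  have "compactin (product_topology (\<lambda>_. euclidean) UNIV)
      (PiE UNIV (\<lambda>x. if x \<in> S then {-1..1::real} else {0}))"
    by (subst compactin_PiE) auto
  moreover have "PiE UNIV (\<lambda>x. if x \<in> S then {-1..1::real} else {0}) =
      {f. (\<forall>x. x \<notin> S \<longrightarrow> f x = 0) \<and> (\<forall>x \<in> S. f x \<in> {-1..1})}"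
    by (auto simp: PiE_iff split: if_splits)
  ultimately show ?thesis by (simp add: euclidean_product_topology)
qed

lemma nonneg_quadratic_imp_linear_zero:
  fixes b c :: real
  assumes "\<And>t. 0 \<le> 2 * t * b + t\<^sup>2 * c"
  shows "b = 0"
proof (rule ccontr)
  assume "b \<noteq> 0"
  define M where "M = \<bar>c\<bar> + 1"
  have M: "0 < M" "c < M" by (auto simp: M_def)
  \<comment> \<open>Near 0 the linear term dominates. A step of size \<open>1 / M\<close> against
    the sign of \<open>b\<close> makes the value negative because \<open>c < M\<close>.\<close>
  have "0 \<le> 2 * (- b / M) * b + (- b / M)\<^sup>2 * c" by (rule assms)
  also have "\<dots> = (b\<^sup>2 / M) * (c / M - 2)"
    using M by (simp add: field_simps power2_eq_square)
  also have "\<dots> < 0"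
    using M \<open>b \<noteq> 0\<close> by (intro mult_pos_neg) (auto simp: field_simps)
  finally show False by simp
qed

text \<open>Variational argument: the quadratic form \<open>Q\<close> attains its minimum on the
  compact unit sphere, the minimizer is an eigenvector, and every eigenvalue is a Rayleigh quotient,
  hence at least that minimum.\<close>

lemma symmetric_least_eigenvalue:
  fixes a :: "'i \<Rightarrow> 'i \<Rightarrow> real" and S :: "'i set"
  defines "eig \<equiv> \<lambda>l. \<exists>f. (\<exists>x\<in>S. f x \<noteq> 0) \<and> (\<forall>x\<in>S. (\<Sum>y\<in>S. a x y * f y) = l * f x)"
  assumes fin: "finite S" and ne: "S \<noteq> {}" and symm: "\<And>x y. a x y = a y x"
  shows "\<exists>l. eig l \<and> (\<forall>l'. eig l' \<longrightarrow> l \<le> l')"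
proof -
  define N where "N = (\<lambda>f :: 'i \<Rightarrow> real. \<Sum>x\<in>S. (f x)\<^sup>2)"
  define A where "A = (\<lambda>(f :: 'i \<Rightarrow> real) x. \<Sum>y\<in>S. a x y * f y)"
  define Q where "Q = (\<lambda>f. \<Sum>x\<in>S. A f x * f x)"
  \<comment> \<open>Values off \<open>S\<close> do not enter \<open>N\<close>; fixing them to 0
    makes the sphere compact.\<close>
  define K where "K = {f :: 'i \<Rightarrow> real. (\<forall>x. x \<notin> S \<longrightarrow> f x = 0) \<and> N f = 1}"
  have contN: "continuous_on UNIV N" and contQ: "continuous_on UNIV Q"
    unfolding N_def Q_def A_def by (intro continuous_intros; simp)+
  have K_box: "K \<subseteq> {f. (\<forall>x. x \<notin> S \<longrightarrow> f x = 0) \<and> (\<forall>x \<in> S. f x \<in> {-1..1})}"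
  proof -
    have "\<bar>f x\<bar> \<le> 1" if "f \<in> K" "x \<in> S" for f x
    proof -
      have "(f x)\<^sup>2 \<le> N f" unfolding N_def using fin that by (intro member_le_sum) auto
      then show ?thesis using that by (simp add: K_def abs_square_le_1)
    qed
    then show ?thesis by (fastforce simp: K_def abs_le_iff)
  qed
  have "K = {f. (\<forall>x. x \<notin> S \<longrightarrow> f x = 0) \<and> (\<forall>x \<in> S. f x \<in> {-1..1})} \<inter> {f. N f = 1}"
    using K_box unfolding K_def by blast
  moreover have "closed {f. N f = 1}"
    using contN by (intro closed_Collect_eq) auto
  ultimately have "compact K"
    using compact_function_box[of S] by (simp add: compact_Int_closed)
  moreover have "K \<noteq> {}"
  proof -
    obtain s where "s \<in> S" using ne by blast
    then have "(\<lambda>x. if x = s then 1 else 0) \<in> K"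
      using fin by (auto simp: K_def N_def if_distrib[of "\<lambda>x. x\<^sup>2"] cong: if_cong)
    then show ?thesis by blast
  qed
  ultimately obtain f where f: "f \<in> K" "\<And>g. g \<in> K \<Longrightarrow> Q f \<le> Q g"
    using continuous_attains_inf[of K Q] contQ continuous_on_subset by blast
  define l where "l = Q f"
  have N_pos: "0 < N g" if "x \<in> S" "g x \<noteq> 0" for g x
    unfolding N_def using that fin by (intro sum_pos2[of S x]) auto
  have rayleigh: "l * N g \<le> Q g" for g
  proof (cases "\<exists>x\<in>S. g x \<noteq> 0")
    case False
    then show ?thesis by (simp add: N_def Q_def A_def)
  next
    case True
    then have Ng: "0 < N g" using N_pos by blast
    \<comment> \<open>\<open>Q\<close> and \<open>N\<close> are both homogeneous of degree 2, so the
      bound on the sphere extends by scaling.\<close>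
    define h where "h = (\<lambda>x. if x \<in> S then g x / sqrt (N g) else 0)"
    have "N h = (\<Sum>x\<in>S. (h x)\<^sup>2)" by (simp add: N_def)
    also have "\<dots> = (\<Sum>x\<in>S. (g x)\<^sup>2 / N g)"
      using Ng by (intro sum.cong) (auto simp: h_def power_divide)
    finally have "N h = 1"
      using Ng by (simp add: sum_divide_distrib[symmetric] N_def)
    moreover have "Q h = (\<Sum>x\<in>S. A g x * g x / N g)"
      unfolding Q_def
    proof (intro sum.cong refl)
      fix x assume "x \<in> S"
      have "A h x = A g x / sqrt (N g)"
        unfolding A_def sum_divide_distrib by (intro sum.cong) (auto simp: h_def)
      then show "A h x * h x = A g x * g x / N g"
        using \<open>x \<in> S\<close> Ng by (simp add: h_def)
    qed
    then have "Q h = Q g / N g"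
      by (simp add: sum_divide_distrib[symmetric] Q_def)
    ultimately have "l \<le> Q g / N g"
      using f(2)[of h] by (simp add: K_def h_def l_def)
    then show ?thesis using Ng by (simp add: field_simps)
  qed
  \<comment> \<open>Perturbing the minimizer in the direction of its own residual shows that the residual vanishes.\<close>
  define r where "r = (\<lambda>x. A f x - l * f x)"
  have "0 \<le> 2 * t * N r + t\<^sup>2 * (Q r - l * N r)" for t
  proof -
    define g where "g = (\<lambda>x. f x + t * r x)"
    have A_g: "A g x = A f x + t * A r x" for x
      unfolding A_def g_def sum_distrib_left sum.distrib[symmetric]
      by (intro sum.cong) (auto simp: algebra_simps)
    \<comment> \<open>Symmetry of \<open>a\<close> enters here: \<open>A\<close> is self-adjoint, so
      the two mixed terms of \<open>Q g\<close> agree.\<close>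
    have cross: "(\<Sum>x\<in>S. A r x * f x) = (\<Sum>x\<in>S. A f x * r x)"
    proof -
      have "(\<Sum>x\<in>S. A r x * f x) = (\<Sum>x\<in>S. \<Sum>y\<in>S. a x y * r y * f x)"
        by (simp add: A_def sum_distrib_right)
      also have "\<dots> = (\<Sum>y\<in>S. \<Sum>x\<in>S. a x y * r y * f x)"
        by (rule sum.swap)
      also have "\<dots> = (\<Sum>x\<in>S. A f x * r x)"
        unfolding A_def sum_distrib_right
        by (intro sum.cong refl) (simp add: symm mult_ac)
      finally show ?thesis .
    qed
    have "Q g = (\<Sum>x\<in>S. A f x * f x + t * (A r x * f x) + t * (A f x * r x) + t\<^sup>2 * (A r x * r x))"
      unfolding Q_def A_g by (intro sum.cong) (auto simp: g_def algebra_simps power2_eq_square)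
    also have "\<dots> = Q f + 2 * t * (\<Sum>x\<in>S. A f x * r x) + t\<^sup>2 * Q r"
      by (simp add: sum.distrib sum_distrib_left[symmetric] cross Q_def)
    finally have Qg: "Q g = l + 2 * t * (\<Sum>x\<in>S. A f x * r x) + t\<^sup>2 * Q r"
      by (simp add: l_def)
    have "N g = (\<Sum>x\<in>S. (f x)\<^sup>2 + 2 * t * (f x * r x) + t\<^sup>2 * (r x)\<^sup>2)"
      unfolding N_def by (intro sum.cong) (auto simp: g_def algebra_simps power2_eq_square)
    also have "\<dots> = N f + 2 * t * (\<Sum>x\<in>S. f x * r x) + t\<^sup>2 * N r"
      by (simp add: sum.distrib sum_distrib_left[symmetric] N_def)
    finally have Ng: "N g = 1 + 2 * t * (\<Sum>x\<in>S. f x * r x) + t\<^sup>2 * N r"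
      using f(1) by (simp add: K_def)
    \<comment> \<open>This identifies the coefficient of \<open>2 * t\<close> in
      \<open>Q g - l * N g\<close> as \<open>N r\<close>.\<close>
    have Nr: "N r = (\<Sum>x\<in>S. A f x * r x) - l * (\<Sum>x\<in>S. f x * r x)"
      unfolding N_def sum_distrib_left sum_subtractf[symmetric]
      by (intro sum.cong) (auto simp: r_def algebra_simps power2_eq_square)
    show ?thesis
      using rayleigh[of g] unfolding Qg Ng Nr by (simp add: algebra_simps)
  qed
  then have "N r = 0" by (rule nonneg_quadratic_imp_linear_zero)
  then have "A f x = l * f x" if "x \<in> S" for x
    using fin that by (simp add: N_def sum_nonneg_eq_0_iff r_def)
  moreover have "\<exists>x\<in>S. f x \<noteq> 0"
  proof (rule ccontr)
    assume "\<not> ?thesis"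
    then have "N f = 0" by (simp add: N_def)
    then show False using f(1) by (simp add: K_def)
  qed
  ultimately have "eig l" unfolding eig_def A_def by blast
  moreover have "l \<le> l'" if "eig l'" for l'
  proof -
    obtain g x where g: "x \<in> S" "g x \<noteq> 0" "\<And>x. x \<in> S \<Longrightarrow> A g x = l' * g x"
      using \<open>eig l'\<close> unfolding eig_def A_def by blast
    have "Q g = l' * N g"
      unfolding Q_def N_def sum_distrib_left using g(3)
      by (intro sum.cong) (auto simp: power2_eq_square)
    then show ?thesis using rayleigh[of g] N_pos[of x g] g(1,2) by simp
  qed
  ultimately show ?thesis by blast
qed

text \<open>Discrete maximum principle. At a maximum \<open>x\<close> of
  \<open>\<bar>f\<bar> / g\<close>, with value \<open>T\<close> and \<open>s\<close> the sign of
  \<open>f x\<close>, the function \<open>T * g - s * f\<close> vanishes at \<open>x\<close> and is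
  nonnegative on \<open>N x\<close>. Its Laplacian at \<open>x\<close> is therefore at most 0, which
  compares \<open>m\<close> with \<open>l\<close>.\<close>

lemma eigenvalue_ge_supersolution:
  fixes f g :: "'i \<Rightarrow> real" and N :: "'i \<Rightarrow> 'i set"
  assumes fin: "finite S" and x0: "x0 \<in> S" "f x0 \<noteq> 0"
    and pos: "\<And>x. x \<in> S \<Longrightarrow> 0 < g x"
    and bdry: "\<And>x y. x \<in> S \<Longrightarrow> y \<in> N x \<Longrightarrow> y \<notin> S \<Longrightarrow> f y = 0 \<and> 0 \<le> g y"
    and eq: "\<And>x. x \<in> S \<Longrightarrow> (\<Sum>y\<in>N x. f x - f y) = l * f x"
    and super: "\<And>x. x \<in> S \<Longrightarrow> m * g x \<le> (\<Sum>y\<in>N x. g x - g y)"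
  shows "m \<le> l"
proof -
  define T where "T = Max ((\<lambda>x. \<bar>f x\<bar> / g x) ` S)"
  have T_ge: "\<bar>f x\<bar> / g x \<le> T" if "x \<in> S" for x
    unfolding T_def using fin that by (intro Max_ge) auto
  have "T \<in> (\<lambda>x. \<bar>f x\<bar> / g x) ` S"
    unfolding T_def using fin x0 by (intro Max_in) auto
  then obtain x where x: "x \<in> S" "T = \<bar>f x\<bar> / g x" by blast
  have T_pos: "0 < T" using T_ge[OF x0(1)] x0 pos[OF x0(1)]
    by (smt (verit) divide_pos_pos zero_less_abs_iff)
  define s where "s = sgn (f x)"
  have fx: "s * f x = T * g x" "s * s = 1"
    using x T_pos pos[OF x(1)] by (auto simp: s_def sgn_real_def abs_if field_simps split: if_splits)
  have fy: "s * f y \<le> T * g y" if "y \<in> N x" for y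
  proof (cases "y \<in> S")
    case True
    have "s * f y \<le> \<bar>f y\<bar>" by (auto simp: s_def sgn_real_def)
    also have "\<dots> \<le> T * g y" using T_ge[OF True] pos[OF True] by (simp add: field_simps)
    finally show ?thesis .
  qed (use bdry[OF x(1) that] T_pos in auto)
  have "m * (T * g x) \<le> T * (\<Sum>y\<in>N x. g x - g y)"
    using super[OF x(1)] T_pos by (simp add: mult.left_commute)
  also have "\<dots> \<le> (\<Sum>y\<in>N x. s * (f x - f y))"
    unfolding sum_distrib_left using fx fy by (intro sum_mono) (auto simp: algebra_simps)
  also have "\<dots> = l * (T * g x)"
    using eq[OF x(1)] fx by (simp add: sum_distrib_left[symmetric] mult.left_commute)
  finally show ?thesis using T_pos pos[OF x(1)] by (simp add: mult_le_cancel_right)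
qed

section \<open>Distances in acyclic symmetric relations\<close>

definition avoiding :: "'a rel \<Rightarrow> 'a \<Rightarrow> 'a rel" where
  "avoiding E x = {(a, b) \<in> E. a \<noteq> x \<and> b \<noteq> x}"

text \<open>Relation powers stand in for arc walks, so that walks can be composed, reversed and
  handled by induction on their length alone.\<close>

definition rel_dist :: "'a rel \<Rightarrow> 'a \<Rightarrow> 'a \<Rightarrow> nat" where
  "rel_dist E u v = (LEAST n. (u, v) \<in> E ^^ n)"

lemma rel_dist_le: "(u, v) \<in> E ^^ n \<Longrightarrow> rel_dist E u v \<le> n"
  unfolding rel_dist_def by (rule Least_le)

lemma sym_relpow:
  assumes "sym E" "(u, v) \<in> E ^^ n"
  shows "(v, u) \<in> E ^^ n"
  using assms(2)
proof (induction n arbitrary: v)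
  case (Suc n)
  then show ?case using assms(1) by (metis relpow_Suc_E relpow_Suc_I2 symD)
qed simp

text \<open>
  The assumption \<open>branch\<close> expresses acyclicity: distinct neighbours of a vertex \<open>x\<close> lie in different
  components of the graph without \<open>x\<close>.
\<close>

locale tree_relation =
  fixes V :: "'a set" and E :: "'a rel"
  assumes sym: "sym E"
    and loopfree: "(x, x) \<notin> E"
    and connected: "u \<in> V \<Longrightarrow> v \<in> V \<Longrightarrow> (u, v) \<in> E\<^sup>*"
    and in_verts: "(x, y) \<in> E \<Longrightarrow> x \<in> V"
    and branch: "(x, y) \<in> E \<Longrightarrow> (x, z) \<in> E \<Longrightarrow> (y, z) \<in> (avoiding E x)\<^sup>* \<Longrightarrow> y = z"
begin

abbreviation gdist :: "'a \<Rightarrow> 'a \<Rightarrow> nat" where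
  "gdist \<equiv> rel_dist E"

section \<open>Distances from a root vertex and predecessors\<close>

lemma symD': "(x, y) \<in> E \<Longrightarrow> (y, x) \<in> E"
  using sym by (rule symD)

lemma relpow_dist:
  assumes "u \<in> V" "v \<in> V"
  shows "(u, v) \<in> E ^^ gdist u v"
proof -
  obtain n where "(u, v) \<in> E ^^ n"
    using connected[OF assms] rtrancl_imp_relpow by blast
  then show ?thesis unfolding rel_dist_def by (rule LeastI)
qed

lemma dist_sym: "gdist u v = gdist v u"
  unfolding rel_dist_def using sym_relpow[OF sym] by metis

lemma dist_self [simp]: "gdist u u = 0"
  using rel_dist_le[of u u 0] by simp

lemma dist_eq_0: "u \<in> V \<Longrightarrow> v \<in> V \<Longrightarrow> gdist u v = 0 \<Longrightarrow> u = v"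
  using relpow_dist[of u v] by simp

lemma dist_triangle:
  assumes "u \<in> V" "v \<in> V" "w \<in> V"
  shows "gdist u w \<le> gdist u v + gdist v w"
proof -
  have "(u, w) \<in> E ^^ (gdist u v + gdist v w)"
    unfolding relpow_add using relpow_dist assms by blast
  then show ?thesis by (rule rel_dist_le)
qed

lemma dist_edge_le:
  assumes "c \<in> V" "(x, y) \<in> E"
  shows "gdist c y \<le> Suc (gdist c x)"
proof -
  have "gdist x y \<le> 1" using assms by (intro rel_dist_le) simp
  then show ?thesis
    using dist_triangle[OF assms(1) in_verts[OF assms(2)] in_verts[OF symD'[OF assms(2)]]] by simp
qed

lemma pred_exists:
  assumes "c \<in> V" "v \<in> V" "v \<noteq> c"
  obtains u where "(v, u) \<in> E" "gdist c v = Suc (gdist c u)"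
proof -
  have "gdist c v \<noteq> 0" using dist_eq_0 assms by auto
  then obtain n where n: "gdist c v = Suc n" by (cases "gdist c v") auto
  then have "(c, v) \<in> E ^^ Suc n" using relpow_dist[OF assms(1,2)] by simp
  then obtain u where u: "(c, u) \<in> E ^^ n" "(u, v) \<in> E" by auto
  have "gdist c u \<le> n" using u(1) by (rule rel_dist_le)
  moreover have "gdist c v \<le> Suc (gdist c u)" using dist_edge_le assms(1) u(2) .
  ultimately show ?thesis using that n u(2) symD' by fastforce
qed

lemma avoiding_sym: "(u, v) \<in> (avoiding E x)\<^sup>* \<Longrightarrow> (v, u) \<in> (avoiding E x)\<^sup>*"
proof -
  have "sym (avoiding E x)" unfolding avoiding_def using symD' by (auto intro: symI)
  then show "(u, v) \<in> (avoiding E x)\<^sup>* \<Longrightarrow> (v, u) \<in> (avoiding E x)\<^sup>*"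
    by (rule symD[OF sym_rtrancl])
qed

text \<open>A shortest walk from \<open>v\<close> to \<open>c\<close> moves strictly closer to
  \<open>c\<close> at each step, so after \<open>v\<close> it visits only vertices closer to
  \<open>c\<close> than \<open>x\<close>.\<close>

lemma descend_avoiding:
  assumes "c \<in> V" "v \<in> V" "v \<noteq> x" "gdist c v \<le> gdist c x"
  shows "(v, c) \<in> (avoiding E x)\<^sup>*"
  using assms(2-)
proof (induction "gdist c v" arbitrary: v)
  case 0
  then show ?case using dist_eq_0 assms(1) by auto
next
  case (Suc n)
  then have "v \<noteq> c" by auto
  then obtain u where u: "(v, u) \<in> E" "gdist c v = Suc (gdist c u)"
    using pred_exists assms(1) Suc.prems(1) by blast
  have "u \<noteq> x" using u(2) Suc.prems by auto
  moreover have "(u, c) \<in> (avoiding E x)\<^sup>*"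
    using Suc.hyps u Suc.prems \<open>u \<noteq> x\<close> in_verts symD' by (metis Suc_inject Suc_leD)
  ultimately show ?case
    using u(1) Suc.prems(2) by (auto simp: avoiding_def intro: converse_rtrancl_into_rtrancl)
qed

text \<open>Both neighbours reach \<open>c\<close> without meeting \<open>x\<close>, so they are
  connected off \<open>x\<close> and \<open>branch\<close> identifies them. The non-strict bounds
  also exclude edges between vertices equally far from \<open>c\<close>.\<close>

lemma pred_unique:
  assumes "c \<in> V" "(x, y) \<in> E" "(x, z) \<in> E" "gdist c y \<le> gdist c x" "gdist c z \<le> gdist c x"
  shows "y = z"
proof -
  have "(w, c) \<in> (avoiding E x)\<^sup>*" if "(x, w) \<in> E" "gdist c w \<le> gdist c x" for w
    using descend_avoiding that assms(1) in_verts symD' loopfree by metis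
  then have "(y, z) \<in> (avoiding E x)\<^sup>*"
    using assms avoiding_sym by (meson rtrancl_trans)
  then show ?thesis using branch assms by blast
qed

text \<open>Induction on the last arc: once the walk has visited \<open>c\<close>, the second
  alternative persists, because the distance from \<open>c\<close> grows by at most 1 per
  arc.\<close>

lemma relpow_through:
  assumes "c \<in> V" "(u, w) \<in> E ^^ n" "u \<noteq> c" "u \<in> V"
  shows "(u, w) \<in> (avoiding E c)\<^sup>* \<or> gdist c u + gdist c w \<le> n"
  using assms(2)
proof (induction n arbitrary: w)
  case (Suc n)
  then obtain v where v: "(u, v) \<in> E ^^ n" "(v, w) \<in> E" by auto
  consider "gdist c u + gdist c v \<le> n" | "(u, v) \<in> (avoiding E c)\<^sup>*" "v \<noteq> c" "w \<noteq> c"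
    | "v = c" | "w = c"
    using Suc.IH[OF v(1)] by blast
  then show ?case
  proof cases
    case 1
    then show ?thesis using dist_edge_le[OF assms(1) v(2)] by simp
  next
    case 2
    then have "(v, w) \<in> avoiding E c" using v(2) by (simp add: avoiding_def)
    then show ?thesis using 2(1) by (auto intro: rtrancl_into_rtrancl)
  next
    case 3
    then show ?thesis
      using rel_dist_le[OF v(1)] dist_edge_le[OF assms(1) v(2)] by (simp add: dist_sym)
  next
    case 4
    then show ?thesis using rel_dist_le[OF Suc.prems] by (simp add: dist_sym)
  qed
qed simp

text \<open>A shortest walk from \<open>v\<close> to \<open>c\<close>, stopped one arc early. The
  neighbour \<open>y\<close> of \<open>c\<close> represents the branch at \<open>c\<close> that
  contains \<open>v\<close>.\<close>

lemma ascend_to_neighbour: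
  assumes "c \<in> V" "v \<in> V" "v \<noteq> c"
  obtains y where "(c, y) \<in> E" "(v, y) \<in> (avoiding E c)\<^sup>*" "(v, y) \<in> E ^^ (gdist c v - 1)"
proof -
  have "\<exists>y. (c, y) \<in> E \<and> (v, y) \<in> (avoiding E c)\<^sup>* \<and> (v, y) \<in> E ^^ (gdist c v - 1)"
    using assms(2,3)
  proof (induction "gdist c v" arbitrary: v)
    case 0
    then show ?case using dist_eq_0 assms(1) by auto
  next
    case (Suc n)
    obtain u where u: "(v, u) \<in> E" "gdist c v = Suc (gdist c u)"
      using pred_exists assms(1) Suc.prems by blast
    show ?case
    proof (cases "u = c")
      case True
      then show ?thesis using u symD' by auto
    next
      case False
      have uV: "u \<in> V" using u(1) symD' in_verts by blast
      obtain y where y: "(c, y) \<in> E" "(u, y) \<in> (avoiding E c)\<^sup>*" "(u, y) \<in> E ^^ (gdist c u - 1)"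
        using Suc.hyps(1)[OF _ uV False] Suc.hyps(2) u(2) by auto
      have "(v, u) \<in> avoiding E c" using u(1) False Suc.prems by (simp add: avoiding_def)
      then have "(v, y) \<in> (avoiding E c)\<^sup>*" using y(2) by (rule converse_rtrancl_into_rtrancl)
      moreover have "gdist c u \<noteq> 0" using dist_eq_0 assms(1) uV False by auto
      then have "(v, y) \<in> E ^^ (gdist c v - 1)"
        using relpow_Suc_I2[OF u(1) y(3)] u(2) by simp
      ultimately show ?thesis using y(1) by blast
    qed
  qed
  then show ?thesis using that by blast
qed

text \<open>
  The center is the midpoint \<open>c\<close> of a longest path from \<open>u\<close> to \<open>v\<close>. Since \<open>u\<close> and \<open>v\<close> lie in
  different branches at \<open>c\<close>, the path from any \<open>w\<close> to one of them passes through \<open>c\<close>.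
\<close>

lemma center_exists:
  assumes "u \<in> V" "v \<in> V" "0 < gdist u v"
    and diam: "\<And>x y. x \<in> V \<Longrightarrow> y \<in> V \<Longrightarrow> gdist x y \<le> gdist u v"
  obtains c where "c \<in> V" "\<And>w. w \<in> V \<Longrightarrow> gdist c w \<le> (gdist u v + 1) div 2"
proof -
  define a b where "a = gdist u v div 2" and "b = (gdist u v + 1) div 2"
  have ab: "a + b = gdist u v" "a \<le> b" "0 < b" using assms(3) by (auto simp: a_def b_def)
  have "(u, v) \<in> E ^^ (a + b)" using relpow_dist assms(1,2) ab(1) by simp
  then obtain c where c: "(u, c) \<in> E ^^ a" "(c, v) \<in> E ^^ b"
    unfolding relpow_add by blast
  have "(c, v) \<in> E\<^sup>*" "c \<noteq> v \<Longrightarrow> c \<in> V"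
    using c(2) by (auto dest: relpow_imp_rtrancl elim: converse_rtranclE intro: in_verts)
  then have cV: "c \<in> V" using assms(2) by blast
  \<comment> \<open>The two distances are at most \<open>a\<close> and \<open>b\<close>, and by the
    triangle inequality they add up to at least \<open>a + b\<close>.\<close>
  have d: "gdist c u = a" "gdist c v = b"
    using rel_dist_le[OF c(1)] rel_dist_le[OF c(2)] dist_triangle[OF assms(1) cV assms(2)] ab(1)
    by (simp_all add: dist_sym)
  have vc: "v \<noteq> c" using d ab by auto
  have sep: "(u, v) \<notin> (avoiding E c)\<^sup>*"
  proof
    assume uv: "(u, v) \<in> (avoiding E c)\<^sup>*"
    \<comment> \<open>No arc of \<open>avoiding E c\<close> starts at \<open>c\<close>, so from
      \<open>c\<close> only \<open>c\<close> is reachable, and \<open>v \<noteq> c\<close>.\<close>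
    have uc: "u \<noteq> c"
      using uv vc by (auto elim: converse_rtranclE simp: avoiding_def)
    obtain y where y: "(c, y) \<in> E" "(u, y) \<in> (avoiding E c)\<^sup>*" "(u, y) \<in> E ^^ (a - 1)"
      using ascend_to_neighbour[OF cV assms(1) uc] d by auto
    obtain z where z: "(c, z) \<in> E" "(v, z) \<in> (avoiding E c)\<^sup>*" "(v, z) \<in> E ^^ (b - 1)"
      using ascend_to_neighbour[OF cV assms(2) vc] d by auto
    have "(y, z) \<in> (avoiding E c)\<^sup>*"
      using avoiding_sym[OF y(2)] uv z(2) by simp
    then have "y = z" using branch y(1) z(1) by blast
    \<comment> \<open>In a common branch both walks reach the same neighbour of \<open>c\<close>;
      joining them there skips \<open>c\<close> and is shorter than the distance
      \<open>a + b\<close>.\<close>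
    then have "(u, v) \<in> E ^^ ((a - 1) + (b - 1))"
      unfolding relpow_add using y(3) sym_relpow[OF sym z(3)] by blast
    then show False using rel_dist_le ab by fastforce
  qed
  have "gdist c w \<le> b" if w: "w \<in> V" for w
  \<comment> \<open>Outside the branch of \<open>v\<close>, the diameter bound leaves
    \<open>w\<close> at most \<open>a \<le> b\<close> from \<open>c\<close>. Inside it,
    \<open>w\<close> is outside the branch of \<open>u\<close>, which leaves at most
    \<open>b\<close>; if \<open>u = c\<close>, then \<open>a = 0\<close> and \<open>b\<close> is the
    diameter.\<close>
  proof (cases "(v, w) \<in> (avoiding E c)\<^sup>*")
    case False
    have "gdist c v + gdist c w \<le> gdist v w"
      using relpow_through[OF cV relpow_dist vc] False assms(2) w by blast
    then show ?thesis using diam[OF assms(2) w] d ab by simp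
  next
    case True
    show ?thesis
    proof (cases "u = c")
      case True
      then show ?thesis using diam[OF assms(1) w] d ab by simp
    next
      case False
      have "(u, w) \<notin> (avoiding E c)\<^sup>*"
        using sep True avoiding_sym by (meson rtrancl_trans)
      then have "gdist c u + gdist c w \<le> gdist u w"
        using relpow_through[OF cV relpow_dist False] assms(1) w by blast
      then show ?thesis using diam[OF assms(1) w] d ab by simp
    qed
  qed
  then show ?thesis using that cV unfolding b_def by blast
qed

end

section \<open>Trees as acyclic symmetric relations\<close>

context pair_graph
begin

lemma awalk_imp_relpow: "awalk u p v \<Longrightarrow> (u, v) \<in> parcs G ^^ length p"
  by (induction p arbitrary: u) (auto simp: awalk_simps simp del: relpow.simps(2) intro: relpow_Suc_I2)

lemma relpow_imp_awalk:
  assumes "(u, v) \<in> parcs G ^^ n" "u \<in> pverts G"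
  shows "\<exists>p. awalk u p v \<and> length p = n"
  using assms
proof (induction n arbitrary: u)
  case 0
  then show ?case by (auto simp: awalk_Nil_iff)
next
  case (Suc n)
  then obtain w where w: "(u, w) \<in> parcs G" "(w, v) \<in> parcs G ^^ n"
    by (meson relpow_Suc_E2)
  then obtain p where "awalk w p v" "length p = n"
    using Suc.IH in_arcsD2 by blast
  then show ?case
    using w(1) by (intro exI[of _ "(u, w) # p"]) (simp add: awalk_Cons_iff)
qed

lemma graph_dist_eq_rel_dist:
  assumes "u \<in> pverts G"
  shows "graph_dist G u v = rel_dist (parcs G) u v"
proof -
  have "(\<exists>p. awalk u p v \<and> length p = n) \<longleftrightarrow> (u, v) \<in> parcs G ^^ n" for n
    using awalk_imp_relpow relpow_imp_awalk assms by blast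
  then show ?thesis by (simp add: graph_dist_def rel_dist_def)
qed

text \<open>The condition \<open>y \<noteq> x\<close> matters: the closure is reflexive at
  \<open>x\<close>, whereas every walk from \<open>x\<close> visits \<open>x\<close>.\<close>

lemma rtrancl_avoiding_iff:
  assumes "y \<in> pverts G" "y \<noteq> x"
  shows "(y, z) \<in> (avoiding (parcs G) x)\<^sup>* \<longleftrightarrow> (\<exists>p. awalk y p z \<and> x \<notin> set (pawalk_verts y p))"
proof
  assume "(y, z) \<in> (avoiding (parcs G) x)\<^sup>*"
  then show "\<exists>p. awalk y p z \<and> x \<notin> set (pawalk_verts y p)"
    using assms
  proof (induction rule: converse_rtrancl_induct)
    case base
    then show ?case by (intro exI[of _ "[]"]) (simp add: awalk_Nil_iff)
  next
    case (step y w)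
    then have w: "(y, w) \<in> parcs G" "w \<noteq> x" by (auto simp: avoiding_def)
    then obtain p where "awalk w p z" "x \<notin> set (pawalk_verts w p)"
      using step.IH in_arcsD2 by blast
    then show ?case
      using w step.prems by (intro exI[of _ "(y, w) # p"]) (simp add: awalk_Cons_iff)
  qed
next
  assume "\<exists>p. awalk y p z \<and> x \<notin> set (pawalk_verts y p)"
  then obtain p where "awalk y p z" "x \<notin> set (pawalk_verts y p)" by blast
  then show "(y, z) \<in> (avoiding (parcs G) x)\<^sup>*"
  proof (induction p arbitrary: y)
    case (Cons e p)
    then have "e \<in> parcs G" "y = fst e" "awalk (snd e) p z" "y \<noteq> x" "x \<notin> set (pawalk_verts (snd e) p)"
      by (auto simp: awalk_Cons_iff)
    moreover from this have "snd e \<noteq> x" using hd_in_awalk_verts(1) by metis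
    ultimately have "(y, snd e) \<in> avoiding (parcs G) x" "(snd e, z) \<in> (avoiding (parcs G) x)\<^sup>*"
      using Cons.IH by (auto simp: avoiding_def)
    then show ?case by (rule converse_rtrancl_into_rtrancl)
  qed (simp add: awalk_Nil_iff)
qed

text \<open>Connectedness of a digraph is strong connectedness of its symmetrization, which changes
  nothing here.\<close>

lemma mk_symmetric_with_proj: "mk_symmetric (with_proj G) = G"
proof -
  have "(\<Union>e\<in>parcs G. {(fst e, snd e), (snd e, fst e)}) = parcs G"
    using arcs_symmetric by (fastforce simp: set_eq_iff)
  then show ?thesis by (simp add: mk_symmetric_def)
qed

lemma connected_iff_rtrancl:
  "Digraph_Component.connected (with_proj G) \<longleftrightarrow>
    pverts G \<noteq> {} \<and> (\<forall>u\<in>pverts G. \<forall>v\<in>pverts G. (u, v) \<in> (parcs G)\<^sup>*)"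
proof -
  have "u \<rightarrow>\<^sup>*\<^bsub>with_proj G\<^esub> v \<longleftrightarrow> (u, v) \<in> (parcs G)\<^sup>*" if "u \<in> pverts G" for u v
    using that awalk_imp_relpow relpow_imp_awalk reachable_awalk rtrancl_power by metis
  then show ?thesis
    unfolding connected_def mk_symmetric_with_proj strongly_connected_def by simp
qed

text \<open>Removing the first and last arc of a cycle at \<open>x\<close> leaves a path off
  \<open>x\<close> between two neighbours of \<open>x\<close>; conversely such a path closes up
  through \<open>x\<close>. Length at least 3 corresponds to \<open>y \<noteq> z\<close>, since the
  cycle \<open>x, y, x\<close> returns through the same neighbour.\<close>

lemma cycle_iff_avoiding:
  "(\<exists>p. cycle p \<and> 3 \<le> length p) \<longleftrightarrow>
    (\<exists>x y z. (x, y) \<in> parcs G \<and> (x, z) \<in> parcs G \<and> (y, z) \<in> (avoiding (parcs G) x)\<^sup>* \<and> y \<noteq> z)"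
proof
  assume "\<exists>p. cycle p \<and> 3 \<le> length p"
  then obtain p u where p: "awalk u p u" "distinct (tl (pawalk_verts u p))" "3 \<le> length p"
    unfolding cycle_def by blast
  then obtain e q where q: "p = e # q" by (cases p) auto
  with p obtain q' e' where q': "q = q' @ [e']" by (cases q rule: rev_cases) auto
  have arcs: "e \<in> parcs G" "fst e = u" "e' \<in> parcs G" "snd e' = u"
    using p(1) unfolding q q' by (auto simp: awalk_simps)
  have walk: "awalk (snd e) q' (fst e')"
    using p(1) unfolding q q' by (auto simp: awalk_simps)
  have "pawalk_verts (snd e) q = pawalk_verts (snd e) q' @ [u]"
    using walk arcs p(1) unfolding q q' by (subst awalk_verts_append[of _ _ _ u]) (auto simp: awalk_simps)
  then have d: "distinct (pawalk_verts (snd e) q')" "u \<notin> set (pawalk_verts (snd e) q')"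
    using p(2) unfolding q by auto
  have "q' \<noteq> []" using p(3) unfolding q q' by auto
  then have "snd e \<noteq> fst e'"
    using apath_nonempty_ends[of "snd e" q' "fst e'"] walk d by (auto simp: apath_def)
  moreover have "(snd e, fst e') \<in> (avoiding (parcs G) u)\<^sup>*"
    using rtrancl_avoiding_iff[of "snd e" u] walk d(2) arcs hd_in_awalk_verts(1)[OF walk]
      arc_snd_in_verts by metis
  moreover have "(u, snd e) \<in> parcs G" "(u, fst e') \<in> parcs G"
    using arcs arcs_symmetric by (metis prod.collapse)+
  ultimately show "\<exists>x y z. (x, y) \<in> parcs G \<and> (x, z) \<in> parcs G \<and>
      (y, z) \<in> (avoiding (parcs G) x)\<^sup>* \<and> y \<noteq> z" by blast
next
  assume "\<exists>x y z. (x, y) \<in> parcs G \<and> (x, z) \<in> parcs G \<and> (y, z) \<in> (avoiding (parcs G) x)\<^sup>* \<and> y \<noteq> z"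
  then obtain x y z where xyz: "(x, y) \<in> parcs G" "(x, z) \<in> parcs G"
    "(y, z) \<in> (avoiding (parcs G) x)\<^sup>*" "y \<noteq> z" by blast
  then obtain p where p: "awalk y p z" "x \<notin> set (pawalk_verts y p)"
    using rtrancl_avoiding_iff[of y x z] in_arcsD2 no_loops' by blast
  \<comment> \<open>A cycle must not repeat inner vertices. Shortening the walk to a path only drops
    vertices, so \<open>x\<close> stays avoided.\<close>
  define q where "q = awalk_to_apath p"
  have q: "apath y q z" unfolding q_def using p(1) by (rule apath_awalk_to_apath)
  have qx: "x \<notin> set (pawalk_verts y q)"
    using awalk_to_apath_subset[OF p(1)] p set_awalk_verts[OF p(1)]
      set_awalk_verts[OF awalkI_apath[OF q]] unfolding q_def by auto
  have "q \<noteq> []" using q xyz(4) by (auto simp: apath_Nil_iff)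
  have walk: "awalk y q z" using q by (rule awalkI_apath)
  then have walk': "awalk y (q @ [(z, x)]) x"
    using xyz(2) arcs_symmetric by (auto simp: awalk_simps dest: in_arcsD1)
  then have "pawalk_verts y (q @ [(z, x)]) = pawalk_verts y q @ [x]"
    using walk by (subst awalk_verts_append) auto
  then have "cycle ((x, y) # q @ [(z, x)])"
    using walk' xyz(1) q qx unfolding cycle_def
    by (intro exI[of _ x]) (auto simp: awalk_Cons_iff apath_def)
  moreover have "3 \<le> length ((x, y) # q @ [(z, x)])" using \<open>q \<noteq> []\<close> by (cases q) auto
  ultimately show "\<exists>p. cycle p \<and> 3 \<le> length p" by blast
qed

text \<open>The absence of cycles of length at least 3 is exactly \<open>branch\<close>.
  Nonemptiness is listed separately because connectedness includes it and the locale does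
  not.\<close>

lemma undirected_tree_iff_tree_relation:
  "undirected_tree G \<longleftrightarrow> pverts G \<noteq> {} \<and> tree_relation (pverts G) (parcs G)"
proof -
  have "sym (parcs G)" "\<And>x. (x, x) \<notin> parcs G" "\<And>x y. (x, y) \<in> parcs G \<Longrightarrow> x \<in> pverts G"
    using arcs_symmetric no_loops' in_arcsD1 by (auto intro: symI)
  then have "tree_relation (pverts G) (parcs G) \<longleftrightarrow>
      (\<forall>u\<in>pverts G. \<forall>v\<in>pverts G. (u, v) \<in> (parcs G)\<^sup>*) \<and> \<not> (\<exists>p. cycle p \<and> 3 \<le> length p)"
    unfolding tree_relation_def cycle_iff_avoiding by blast
  then show ?thesis
    unfolding undirected_tree_def connected_iff_rtrancl using pair_graph by blast
qed

lemma boundary_iff: "v \<in> boundary G \<longleftrightarrow> v \<in> pverts G \<and> card {y. (v, y) \<in> parcs G} = 1"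
proof -
  have "out_arcs (with_proj G) v = Pair v ` {y. (v, y) \<in> parcs G}"
    by (auto simp: out_arcs_def)
  then have "out_degree (with_proj G) v = card {y. (v, y) \<in> parcs G}"
    by (simp add: out_degree_def card_image inj_on_def)
  then show ?thesis by (simp add: boundary_def)
qed

end

section \<open>Lower bounds for the first Dirichlet eigenvalue\<close>

lemma four_sin_half_squared: "4 * (sin (t / 2))\<^sup>2 = 2 - 2 * cos (t :: real)"
  using cos_double_sin[of "t / 2"] by simp

text \<open>Sampled sines are eigenfunctions of the second difference. This serves both the radial
  function on a tree and the eigenfunction on a path.\<close>

lemma sin_second_difference:
  fixes t h :: real
  shows "2 * sin t - sin (t + h) - sin (t - h) = 4 * (sin (h / 2))\<^sup>2 * sin t"
  unfolding four_sin_half_squared by (simp add: sin_add sin_diff algebra_simps)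

text \<open>Concavity puts the sine above its chord from 0 to \<open>pi / 6\<close>, where it equals
  \<open>1 / 2\<close>; then \<open>2 * r + 1 \<le> 3 * r\<close> gives the bound.\<close>

lemma inverse_square_le_four_sin_squared:
  fixes r :: real
  assumes "1 \<le> r"
  shows "1 / r\<^sup>2 \<le> 4 * (sin (pi / (4 * r + 2)))\<^sup>2"
proof -
  have "concave_on {0..pi} sin"
    by (rule f''_le0_imp_concave[where f' = cos and f'' = "\<lambda>x. - sin x"])
      (auto intro!: derivative_eq_intros sin_ge_zero)
  \<comment> \<open>Chosen so that \<open>t * (pi / 6) = pi / (4 * r + 2)\<close>.\<close>
  moreover define t where "t = 3 / (2 * r + 1)"
  moreover have "0 \<le> t" "t \<le> 1" using assms by (auto simp: t_def field_simps)
  ultimately have "(1 - t) * sin 0 + t * sin (pi / 6) \<le> sin ((1 - t) *\<^sub>R 0 + t *\<^sub>R (pi / 6))"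
    by (intro concave_onD[of "{0..pi}"]) auto
  also have "(1 - t) *\<^sub>R 0 + t *\<^sub>R (pi / 6) = pi / (4 * r + 2)"
    using assms by (simp add: t_def field_simps)
  finally have "t / 2 \<le> sin (pi / (4 * r + 2))" by (simp add: sin_30)
  moreover have "1 / (2 * r) \<le> t / 2" using assms by (simp add: t_def field_simps)
  ultimately have "1 / (2 * r) \<le> sin (pi / (4 * r + 2))" by simp
  then have "(1 / (2 * r))\<^sup>2 \<le> (sin (pi / (4 * r + 2)))\<^sup>2"
    using assms by (intro power_mono) auto
  then show ?thesis by (simp add: power_divide power_mult_distrib)
qed

section \<open>The Dirichlet problem on a tree and the radial comparison function\<close>

context pair_graph
begin

lemma finite_neighbours: "finite {y. (x, y) \<in> parcs G}"
  by (rule finite_subset[OF _ pair_finite_verts]) (auto dest: in_arcsD2)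

text \<open>\<open>a\<close> is degree matrix minus adjacency matrix. Zero boundary values delete
  the boundary columns, which leaves a symmetric matrix indexed by the interior.\<close>

lemma dirichlet_eigenvalue_iff_matrix:
  defines "a \<equiv> \<lambda>x y. (if x = y then real (card {y. (x, y) \<in> parcs G}) else 0)
                        - (if (x, y) \<in> parcs G then 1 else 0)"
  shows "dirichlet_eigenvalue G l \<longleftrightarrow>
    (\<exists>f. (\<exists>x\<in>interior_verts G. f x \<noteq> 0) \<and>
         (\<forall>x\<in>interior_verts G. (\<Sum>y\<in>interior_verts G. a x y * f y) = l * f x))"
    (is "_ \<longleftrightarrow> (\<exists>f. ?nz f \<and> ?eq f)")
proof -
  let ?S = "interior_verts G"
  have fin: "finite ?S" using pair_finite_verts by (simp add: interior_verts_def)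
  have mat: "(\<Sum>y\<in>?S. a x y * f y) = (\<Sum>y\<in>{y. (x, y) \<in> parcs G}. f x - f y)"
    if x: "x \<in> ?S" and f: "\<forall>y\<in>boundary G. f y = 0" for x and f :: "'a \<Rightarrow> real"
  proof -
    have "(\<Sum>y\<in>?S. a x y * f y) =
        (\<Sum>y\<in>?S. if x = y then real (card {y. (x, y) \<in> parcs G}) * f x else 0)
        - (\<Sum>y\<in>?S. if (x, y) \<in> parcs G then f y else 0)"
      unfolding a_def sum_subtractf[symmetric] by (intro sum.cong) (auto simp: algebra_simps)
    also have "(\<Sum>y\<in>?S. if x = y then real (card {y. (x, y) \<in> parcs G}) * f x else 0)
        = real (card {y. (x, y) \<in> parcs G}) * f x"
      using fin x by simp
    also have "(\<Sum>y\<in>?S. if (x, y) \<in> parcs G then f y else 0) = (\<Sum>y\<in>{y. (x, y) \<in> parcs G}. f y)"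
      using fin f finite_neighbours[of x] in_arcsD2
      by (intro sum.mono_neutral_cong) (auto simp: interior_verts_def)
    finally show ?thesis by (simp add: sum_subtractf)
  qed
  show ?thesis
  proof
    assume "dirichlet_eigenvalue G l"
    then obtain f where f: "\<exists>x\<in>pverts G. f x \<noteq> 0" "\<forall>x\<in>boundary G. f x = 0"
      "\<forall>x\<in>?S. (\<Sum>y\<in>{y. (x, y) \<in> parcs G}. f x - f y) = l * f x"
      unfolding dirichlet_eigenvalue_def by blast
    have "?nz f" using f(1,2) by (auto simp: interior_verts_def)
    moreover have "?eq f" using mat f by simp
    ultimately show "\<exists>f. ?nz f \<and> ?eq f" by blast
  next
    assume "\<exists>f. ?nz f \<and> ?eq f"
    then obtain f where f: "?nz f" "?eq f" by blast
    \<comment> \<open>The matrix equation says nothing about \<open>f\<close> off the interior, so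
      the boundary values are set to 0.\<close>
    define g where "g = (\<lambda>x. if x \<in> ?S then f x else 0)"
    have g0: "\<forall>y\<in>boundary G. g y = 0" by (simp add: g_def interior_verts_def)
    have "(\<Sum>y\<in>{y. (x, y) \<in> parcs G}. g x - g y) = l * g x" if "x \<in> ?S" for x
    proof -
      have "(\<Sum>y\<in>?S. a x y * g y) = (\<Sum>y\<in>?S. a x y * f y)"
        by (intro sum.cong) (auto simp: g_def)
      then show ?thesis using mat[OF that g0] f(2) that by (simp add: g_def)
    qed
    moreover have "\<exists>x\<in>pverts G. g x \<noteq> 0"
      using f(1) by (auto simp: g_def interior_verts_def)
    ultimately show "dirichlet_eigenvalue G l"
      unfolding dirichlet_eigenvalue_def using g0 by blast
  qed
qed

text \<open>\<open>lambda1\<close> is a \<open>LEAST\<close> over the reals, which is informative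
  only once a minimum is known to exist; the symmetric matrix provides it.\<close>

lemma
  assumes "interior_verts G \<noteq> {}"
  shows dirichlet_eigenvalue_lambda1: "dirichlet_eigenvalue G (lambda1 G)"
    and lambda1_le: "dirichlet_eigenvalue G l \<Longrightarrow> lambda1 G \<le> l"
proof -
  have "\<exists>l. dirichlet_eigenvalue G l \<and> (\<forall>l'. dirichlet_eigenvalue G l' \<longrightarrow> l \<le> l')"
    unfolding dirichlet_eigenvalue_iff_matrix
  proof (rule symmetric_least_eigenvalue)
    show "finite (interior_verts G)" using pair_finite_verts by (simp add: interior_verts_def)
  qed (use assms arcs_symmetric in auto)
  then obtain l0 where l0: "dirichlet_eigenvalue G l0"
    "\<And>l'. dirichlet_eigenvalue G l' \<Longrightarrow> l0 \<le> l'" by blast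
  then have "lambda1 G = l0" unfolding lambda1_def by (intro Least_equality)
  then show "dirichlet_eigenvalue G (lambda1 G)" "dirichlet_eigenvalue G l \<Longrightarrow> lambda1 G \<le> l"
    using l0 by auto
qed

text \<open>An interior vertex has degree other than 1, and connectedness excludes degree 0, so some
  neighbour differs from any prescribed \<open>u\<close>.\<close>

lemma interior_neighbour:
  assumes tree: "tree_relation (pverts G) (parcs G)" and card: "2 \<le> card (pverts G)"
    and x: "x \<in> interior_verts G"
  obtains y where "(x, y) \<in> parcs G" "y \<noteq> u"
proof -
  interpret tree_relation "pverts G" "parcs G" by (fact tree)
  have xV: "x \<in> pverts G" "x \<notin> boundary G" using x by (auto simp: interior_verts_def)
  have "\<not> pverts G \<subseteq> {x}"
    using card_mono[of "{x}" "pverts G"] card by auto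
  then obtain v where "v \<in> pverts G" "v \<noteq> x" by blast
  then have "{y. (x, y) \<in> parcs G} \<noteq> {}"
    using connected[OF xV(1)] by (auto elim: converse_rtranclE)
  then have "\<not> {y. (x, y) \<in> parcs G} \<subseteq> {u}"
    using xV by (auto simp: boundary_iff subset_singleton_iff)
  then show ?thesis using that by blast
qed

text \<open>If all degrees were 1, a vertex and its only neighbour would form a whole component, so
  there would be at most two vertices.\<close>

lemma interior_nonempty:
  assumes tree: "tree_relation (pverts G) (parcs G)" and card: "3 \<le> card (pverts G)"
  shows "interior_verts G \<noteq> {}"
proof
  interpret tree_relation "pverts G" "parcs G" by (fact tree)
  assume "interior_verts G = {}"
  then have deg: "\<exists>y. {z. (x, z) \<in> parcs G} = {y}" if "x \<in> pverts G" for x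
    using that unfolding interior_verts_def by (auto simp: boundary_iff card_1_singleton_iff)
  have "pverts G \<noteq> {}" using card by auto
  then obtain x where x: "x \<in> pverts G" by blast
  obtain y where y: "{z. (x, z) \<in> parcs G} = {y}" using deg x by blast
  then have xy: "(x, y) \<in> parcs G" by blast
  then have yx: "(y, x) \<in> parcs G" "y \<in> pverts G" using arcs_symmetric in_arcsD2 by auto
  then obtain w where "{z. (y, z) \<in> parcs G} = {w}" using deg by blast
  then have y': "{z. (y, z) \<in> parcs G} = {x}" using yx(1) by auto
  have "v \<in> {x, y}" if "(x, v) \<in> (parcs G)\<^sup>*" for v
    using that by (induction rule: rtrancl_induct) (use y y' in auto)
  then have "pverts G \<subseteq> {x, y}" using connected x by blast
  then have "card (pverts G) \<le> card {x, y}" by (intro card_mono) auto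
  also have "\<dots> \<le> 2" by (simp add: card_insert_if)
  finally show False using card by simp
qed

text \<open>The profile \<open>p\<close> is the first Dirichlet mode of a path with
  \<open>2 * R + 1\<close> edges, with zeros at \<open>k = R\<close> and
  \<open>k = - (R + 1)\<close>, folded at its middle edge. Further branches of the tree only add
  nonnegative differences.\<close>

lemma lambda1_ge_of_eccentricity:
  assumes tree: "tree_relation (pverts G) (parcs G)" and card: "3 \<le> card (pverts G)"
    and c: "c \<in> pverts G" and ecc: "\<And>w. w \<in> pverts G \<Longrightarrow> rel_dist (parcs G) c w \<le> R"
  shows "4 * (sin (pi / (4 * real R + 2)))\<^sup>2 \<le> lambda1 G"
proof -
  interpret tree_relation "pverts G" "parcs G" by (fact tree)
  let ?S = "interior_verts G"
  let ?N = "\<lambda>x. {y. (x, y) \<in> parcs G}"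
  define h where "h = pi / (2 * real R + 1)"
  define m where "m = 4 * (sin (h / 2))\<^sup>2"
  define p where "p = (\<lambda>k :: nat. sin (h * (real R - real k)))"
  have h: "0 < h" "h * (2 * real R + 1) = pi" by (auto simp: h_def)
  \<comment> \<open>All arguments up to \<open>h * R\<close> stay in the range where the sine
    increases, so \<open>p\<close> decreases with the distance.\<close>
  have hR: "h * real R \<le> pi / 2" using h by (simp add: algebra_simps)
  have p_pos: "0 < p k" if "k < R" for k
  proof -
    have "0 < h * (real R - real k)" using h that by simp
    moreover have "h * (real R - real k) \<le> h * real R" using h by simp
    ultimately show ?thesis unfolding p_def using hR by (intro sin_gt_zero) auto
  qed
  have p_nonneg: "0 \<le> p k" if "k \<le> R" for k
    using p_pos[of k] that by (cases "k = R") (auto simp: p_def)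
  have p_anti: "p (Suc k) \<le> p k" if "k < R" for k
  proof -
    have "h * (real R - real k) \<le> h * real R" using h by simp
    then have "h * (real R - real k) \<le> pi / 2" using hR by linarith
    moreover have "0 \<le> h * (real R - real (Suc k))" using h that by simp
    then have "- (pi / 2) \<le> h * (real R - real (Suc k))" using pi_gt_zero by linarith
    moreover have "h * (real R - real (Suc k)) \<le> h * (real R - real k)" using h by simp
    ultimately show ?thesis unfolding p_def by (intro sin_monotone_2pi_le)
  qed
  have p_step: "2 * p (Suc k) - p k - p (Suc (Suc k)) = m * p (Suc k)" for k
    using sin_second_difference[of "h * (real R - real (Suc k))" h]
    by (simp add: p_def m_def algebra_simps)
  \<comment> \<open>The step at \<open>c\<close> is reflecting: the sine takes the same value at \<open>h R\<close> and at \<open>h (R + 1) = \<pi> - h R\<close>.\<close>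
  have p_root: "p 0 - p 1 = m * p 0"
  proof -
    have "h * real R + h = pi - h * real R" using h by (simp add: algebra_simps)
    then have "sin (h * real R + h) = sin (h * real R)" by (simp only: sin_pi_minus)
    then show ?thesis
      using sin_second_difference[of "h * real R" h] by (simp add: p_def m_def algebra_simps)
  qed
  define g where "g = (\<lambda>x. p (gdist c x))"
  have succ: "gdist c y = Suc (gdist c x)"
    if "(x, u) \<in> parcs G" "gdist c u \<le> gdist c x" "(x, y) \<in> parcs G" "y \<noteq> u" for x y u
    using pred_unique[OF c that(3,1)] that dist_edge_le[OF c that(3)] by fastforce
  \<comment> \<open>An interior vertex has a neighbour farther from \<open>c\<close>, which is still
    within \<open>R\<close>. This makes \<open>g\<close> strictly positive on the interior.\<close>
  have key: "gdist c x < R \<and> m * g x \<le> (\<Sum>y\<in>?N x. g x - g y)" if x: "x \<in> ?S" for x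
  proof (cases "x = c")
    case True
    have d1: "gdist c y = 1" if "(x, y) \<in> parcs G" for y
    proof -
      have "y \<noteq> c" "y \<in> pverts G" using that True loopfree in_arcsD2 by auto
      then have "gdist c y \<noteq> 0" using dist_eq_0 c by blast
      then show ?thesis using dist_edge_le[OF c that] True by simp
    qed
    obtain y where y: "(x, y) \<in> parcs G"
      using interior_neighbour[OF tree _ x] card by (metis Suc_leD numeral_2_eq_2 numeral_3_eq_3)
    then have R: "0 < R" using ecc[of y] d1 in_arcsD2 by fastforce
    \<comment> \<open>One neighbour of \<open>c\<close> already gives equality; every other
      neighbour contributes a nonnegative term.\<close>
    have "m * g x = g x - g y" using True d1[OF y] p_root by (simp add: g_def)
    also have "\<dots> \<le> (\<Sum>y\<in>?N x. g x - g y)"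
      using y finite_neighbours[of x] d1 True p_anti[OF R]
      by (intro member_le_sum) (auto simp: g_def)
    finally show ?thesis using True R by simp
  next
    case False
    have "x \<in> pverts G" using x by (simp add: interior_verts_def)
    then obtain u where u: "(x, u) \<in> parcs G" "gdist c x = Suc (gdist c u)"
      using pred_exists[OF c _ False] by blast
    obtain y where y: "(x, y) \<in> parcs G" "y \<noteq> u"
      using interior_neighbour[OF tree _ x] card by (metis Suc_leD numeral_2_eq_2 numeral_3_eq_3)
    have up: "gdist c z = Suc (gdist c x)" if "z \<in> ?N x - {u}" for z
      using succ[OF u(1)] that u(2) by simp
    have R: "gdist c x < R" using up[of y] y ecc[of y] in_arcsD2 by fastforce
    \<comment> \<open>The predecessor \<open>u\<close> and one farther neighbour \<open>y\<close>
      give equality by the recurrence; the other neighbours are farther too and add nonnegative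
      terms.\<close>
    have "m * g x = (g x - g u) + (g x - g y)"
      using p_step[of "gdist c u"] u(2) up[of y] y by (simp add: g_def algebra_simps)
    also have "g x - g y \<le> (\<Sum>z\<in>?N x - {u}. g x - g z)"
      using y finite_neighbours[of x] up p_anti[OF R]
      by (intro member_le_sum) (auto simp: g_def)
    also have "(g x - g u) + (\<Sum>z\<in>?N x - {u}. g x - g z) = (\<Sum>z\<in>?N x. g x - g z)"
      using u(1) finite_neighbours[of x] by (subst sum.remove[of _ u]) auto
    finally show ?thesis using R by simp
  qed
  have "interior_verts G \<noteq> {}" using interior_nonempty tree card .
  then obtain f where f: "\<exists>x\<in>pverts G. f x \<noteq> 0" "\<forall>x\<in>boundary G. f x = 0"
    "\<forall>x\<in>?S. (\<Sum>y\<in>?N x. f x - f y) = lambda1 G * f x"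
    using dirichlet_eigenvalue_lambda1 unfolding dirichlet_eigenvalue_def by blast
  obtain x0 where x0: "x0 \<in> ?S" "f x0 \<noteq> 0" using f(1,2) by (auto simp: interior_verts_def)
  have "m \<le> lambda1 G"
  proof (rule eigenvalue_ge_supersolution[where S = ?S and f = f and g = g and N = ?N])
    show "finite ?S" using pair_finite_verts by (simp add: interior_verts_def)
    show "f y = 0 \<and> 0 \<le> g y" if "y \<in> ?N x" "y \<notin> ?S" for x y
      using that f(2) in_arcsD2 ecc p_nonneg by (auto simp: interior_verts_def g_def)
  qed (use x0 f(3) key p_pos in \<open>auto simp: g_def\<close>)
  moreover have "h / 2 = pi / (4 * real R + 2)" by (simp add: h_def field_simps)
  ultimately show ?thesis by (simp add: m_def)
qed

text \<open>A vertex in the middle of a longest path has eccentricity at most half the diameter,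
  rounded up. Positivity of the diameter later yields \<open>r \<ge> 1\<close> in the even
  case.\<close>

lemma lambda1_ge_of_diameter:
  assumes "undirected_tree G" and card: "3 \<le> card (pverts G)"
  shows "0 < graph_diameter G"
    and "4 * (sin (pi / (4 * real ((graph_diameter G + 1) div 2) + 2)))\<^sup>2 \<le> lambda1 G"
proof -
  have tree: "tree_relation (pverts G) (parcs G)" and ne: "pverts G \<noteq> {}"
    using assms(1) undirected_tree_iff_tree_relation by auto
  interpret tree_relation "pverts G" "parcs G" by (fact tree)
  let ?D = "(\<lambda>(v, w). graph_dist G v w) ` (pverts G \<times> pverts G)"
  have fin: "finite ?D" using pair_finite_verts by simp
  then have "graph_diameter G \<in> ?D" unfolding graph_diameter_def using ne by (intro Max_in) auto
  then obtain u v where uv: "u \<in> pverts G" "v \<in> pverts G" "graph_diameter G = gdist u v"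
    by (auto simp: graph_dist_eq_rel_dist)
  have max: "gdist x y \<le> gdist u v" if "x \<in> pverts G" "y \<in> pverts G" for x y
  proof -
    have "graph_dist G x y \<le> graph_diameter G"
      unfolding graph_diameter_def using fin that by (intro Max_ge) auto
    then show ?thesis using that uv by (simp add: graph_dist_eq_rel_dist)
  qed
  have "\<not> pverts G \<subseteq> {u}" using card_mono[of "{u}" "pverts G"] card by auto
  then obtain w where "w \<in> pverts G" "w \<noteq> u" by blast
  then have pos: "0 < gdist u v" using max[OF uv(1), of w] dist_eq_0[OF uv(1), of w] by fastforce
  then show "0 < graph_diameter G" using uv by simp
  obtain c where "c \<in> pverts G" "\<And>w. w \<in> pverts G \<Longrightarrow> gdist c w \<le> (gdist u v + 1) div 2"
    using center_exists[OF uv(1,2) pos max] by blast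
  then show "4 * (sin (pi / (4 * real ((graph_diameter G + 1) div 2) + 2)))\<^sup>2 \<le> lambda1 G"
    unfolding uv(3) using lambda1_ge_of_eccentricity[OF tree card] by blast
qed

end

section \<open>Path graphs\<close>

text \<open>The index counts edges, so that it equals the diameter.\<close>

definition path_graph :: "nat \<Rightarrow> nat pair_pre_digraph" where
  "path_graph m = \<lparr>pverts = {0..m}, parcs = {(i, j). i \<le> m \<and> j \<le> m \<and> (j = Suc i \<or> i = Suc j)}\<rparr>"

lemma pverts_path_graph [simp]: "pverts (path_graph m) = {0..m}"
  by (simp add: path_graph_def)

lemma parcs_path_graph [simp]:
  "(i, j) \<in> parcs (path_graph m) \<longleftrightarrow> i \<le> m \<and> j \<le> m \<and> (j = Suc i \<or> i = Suc j)"
  by (simp add: path_graph_def)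

lemma pair_graph_path_graph: "pair_graph (path_graph m)"
proof
  have "parcs (path_graph m) \<subseteq> {0..m} \<times> {0..m}" by auto
  then show "finite (parcs (path_graph m))" by (rule finite_subset) simp
  show "symmetric (with_proj (path_graph m))" by (auto simp: symmetric_def intro: symI)
qed (auto simp: path_graph_def)

interpretation path_graph: pair_graph "path_graph m" for m
  by (rule pair_graph_path_graph)

lemma relpow_path_graph_add: "i + n \<le> m \<Longrightarrow> (i, i + n) \<in> parcs (path_graph m) ^^ n"
proof (induction n)
  case (Suc n)
  then show ?case by (intro relpow_Suc_I[where y = "i + n"]) auto
qed simp

lemma relpow_path_graph_bound:
  "(i, j) \<in> parcs (path_graph m) ^^ n \<Longrightarrow> j \<le> i + n \<and> i \<le> j + n"
proof (induction n arbitrary: j)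
  case (Suc n)
  then obtain k where "(i, k) \<in> parcs (path_graph m) ^^ n" "(k, j) \<in> parcs (path_graph m)"
    by auto
  then show ?case using Suc.IH[of k] by auto
qed simp

lemma sym_path_graph: "sym (parcs (path_graph m))"
  by (auto intro: symI)

text \<open>With truncated subtraction the exponent is the absolute difference of \<open>i\<close>
  and \<open>j\<close>.\<close>

lemma relpow_path_graph:
  assumes "i \<le> m" "j \<le> m"
  shows "(i, j) \<in> parcs (path_graph m) ^^ ((i - j) + (j - i))"
proof (cases "i \<le> j")
  case True
  then show ?thesis using relpow_path_graph_add[of i "j - i" m] assms by simp
next
  case False
  then show ?thesis
    using sym_relpow[OF sym_path_graph relpow_path_graph_add[of j "i - j" m]] assms by simp
qed

lemma graph_dist_path_graph:
  assumes "i \<le> m" "j \<le> m"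
  shows "graph_dist (path_graph m) i j = (i - j) + (j - i)"
proof -
  have "rel_dist (parcs (path_graph m)) i j = (i - j) + (j - i)"
    unfolding rel_dist_def
  proof (rule Least_equality)
    show "(i, j) \<in> parcs (path_graph m) ^^ ((i - j) + (j - i))"
      using assms by (rule relpow_path_graph)
  qed (auto dest: relpow_path_graph_bound)
  then show ?thesis using assms by (simp add: path_graph.graph_dist_eq_rel_dist)
qed

lemma undirected_tree_path_graph: "undirected_tree (path_graph m)"
  unfolding path_graph.undirected_tree_iff_tree_relation
proof
  show "tree_relation (pverts (path_graph m)) (parcs (path_graph m))"
  proof
    show "(u, v) \<in> (parcs (path_graph m))\<^sup>*"
      if "u \<in> pverts (path_graph m)" "v \<in> pverts (path_graph m)" for u v
      using relpow_path_graph[of u m v] that by (auto intro: relpow_imp_rtrancl)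
    fix x y z
    assume xyz: "(x, y) \<in> parcs (path_graph m)" "(x, z) \<in> parcs (path_graph m)"
      "(y, z) \<in> (avoiding (parcs (path_graph m)) x)\<^sup>*"
    \<comment> \<open>Steps have size 1, so a walk that misses \<open>x\<close> stays on one side of
      it, and \<open>x\<close> has at most one neighbour on each side.\<close>
    from xyz(3) have "y < x \<longleftrightarrow> z < x"
      by (induction rule: rtrancl_induct) (auto simp: avoiding_def)
    then show "y = z" using xyz(1,2) by auto
  qed (use sym_path_graph in auto)
qed auto

lemma neighbours_path_graph:
  "0 < i \<Longrightarrow> i < m \<Longrightarrow> {j. (i, j) \<in> parcs (path_graph m)} = {i - 1, i + 1}"
  by auto

lemma boundary_path_graph:
  assumes "2 \<le> m"
  shows "boundary (path_graph m) = {0, m}"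
proof -
  have "{j. (0, j) \<in> parcs (path_graph m)} = {1}" "{j. (m, j) \<in> parcs (path_graph m)} = {m - 1}"
    using assms by auto
  then have "card {j. (0, j) \<in> parcs (path_graph m)} = 1" "card {j. (m, j) \<in> parcs (path_graph m)} = 1"
    by auto
  moreover have "card {j. (i, j) \<in> parcs (path_graph m)} = 2" if "0 < i" "i < m" for i
    using that by (subst neighbours_path_graph) auto
  ultimately show ?thesis
    unfolding set_eq_iff path_graph.boundary_iff
    by (metis One_nat_def atLeastAtMost_iff gr0I insert_iff le_eq_less_or_eq le0 n_not_Suc_n
        numeral_2_eq_2 pverts_path_graph singletonD)
qed

text \<open>A middle vertex is farthest from both ends. Paths with \<open>2 * r\<close> and
  \<open>2 * r + 1\<close> edges both have radius \<open>r\<close>, which realizes the two diameter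
  cases.\<close>

lemma inscribed_radius_path_graph:
  assumes "2 \<le> m"
  shows "inscribed_radius (path_graph m) = m div 2"
proof -
  have "Min (graph_dist (path_graph m) v ` boundary (path_graph m)) = min v (m - v)"
    if "v \<le> m" for v
    using that assms by (simp add: boundary_path_graph graph_dist_path_graph)
  then have "inscribed_radius (path_graph m) = Max ((\<lambda>v. min v (m - v)) ` {0..m})"
    unfolding inscribed_radius_def by (intro arg_cong[where f = Max] image_cong) auto
  also have "\<dots> = m div 2"
  proof (rule Max_eqI)
    show "m div 2 \<in> (\<lambda>v. min v (m - v)) ` {0..m}"
      by (rule image_eqI[of _ _ "m div 2"]) auto
  qed auto
  finally show ?thesis .
qed

lemma graph_diameter_path_graph: "graph_diameter (path_graph m) = m"
  unfolding graph_diameter_def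
proof (rule Max_eqI)
  show "m \<in> (\<lambda>(v, w). graph_dist (path_graph m) v w) ` (pverts (path_graph m) \<times> pverts (path_graph m))"
    by (rule image_eqI[of _ _ "(0, m)"]) (auto simp: graph_dist_path_graph)
qed (auto simp: graph_dist_path_graph)

text \<open>The eigenfunction is half a period of a sine wave, with its zeros at the two
  ends.\<close>

lemma dirichlet_eigenvalue_path_graph:
  assumes "2 \<le> m"
  shows "dirichlet_eigenvalue (path_graph m) (4 * (sin (pi / (2 * real m)))\<^sup>2)"
proof -
  define h where "h = pi / real m"
  define f where "f = (\<lambda>k. sin (h * real k))"
  have "h * real m = pi" using assms by (simp add: h_def)
  then have bd: "\<forall>x\<in>boundary (path_graph m). f x = 0"
    using assms by (auto simp: boundary_path_graph f_def)
  have "0 < h" "h < pi" using assms by (auto simp: h_def field_simps)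
  then have "f 1 \<noteq> 0" unfolding f_def using sin_gt_zero[of h] by simp
  moreover have "(\<Sum>y\<in>{y. (x, y) \<in> parcs (path_graph m)}. f x - f y) = 4 * (sin (h / 2))\<^sup>2 * f x"
    if "x \<in> interior_verts (path_graph m)" for x
  proof -
    have x: "0 < x" "x < m"
      using that assms by (auto simp: interior_verts_def boundary_path_graph)
    then show ?thesis
      using sin_second_difference[of "h * real x" h]
      by (subst neighbours_path_graph) (auto simp: f_def algebra_simps of_nat_diff)
  qed
  moreover have "h / 2 = pi / (2 * real m)" by (simp add: h_def)
  ultimately show ?thesis
    unfolding dirichlet_eigenvalue_def using bd assms
    by (intro exI[of _ f]) (auto intro!: bexI[of _ 1])
qed

lemma lambda1_path_graph_le:
  assumes "2 \<le> m"
  shows "lambda1 (path_graph m) \<le> 16 / (real m)\<^sup>2"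
proof -
  have "interior_verts (path_graph m) \<noteq> {}"
    using undirected_tree_path_graph assms path_graph.undirected_tree_iff_tree_relation
    by (intro path_graph.interior_nonempty) auto
  then have "lambda1 (path_graph m) \<le> 4 * (sin (pi / (2 * real m)))\<^sup>2"
    using dirichlet_eigenvalue_path_graph[OF assms] by (rule path_graph.lambda1_le)
  \<comment> \<open>Uses \<open>\<bar>sin x\<bar> \<le> \<bar>x\<bar>\<close> and the crude bound
    \<open>pi < 4\<close>.\<close>
  also have "\<dots> \<le> 4 * (4 / (2 * real m))\<^sup>2"
  proof -
    have "0 \<le> pi / (2 * real m)" by simp
    moreover have "pi / (2 * real m) \<le> 4 / (2 * real m)"
      using pi_less_4 by (intro divide_right_mono) auto
    ultimately have "\<bar>sin (pi / (2 * real m))\<bar> \<le> 4 / (2 * real m)"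
      using abs_sin_x_le_abs_x[of "pi / (2 * real m)"] by linarith
    then show ?thesis by (simp add: abs_le_square_iff[symmetric])
  qed
  also have "\<dots> = 16 / (real m)\<^sup>2" by (simp add: power_divide power_mult_distrib)
  finally show ?thesis .
qed

theorem theorem1p3:
  shows "(\<forall>T :: 'a pair_pre_digraph. undirected_tree T \<and> card (pverts T) \<ge> 3 \<longrightarrow>
      (let r = inscribed_radius T in
        (graph_diameter T = 2 * r \<longrightarrow>
           lambda1 T \<ge> 4 * (sin (pi / (4 * real r + 2)))\<^sup>2 \<and>
           4 * (sin (pi / (4 * real r + 2)))\<^sup>2 \<ge> 1 / (real r)\<^sup>2) \<and>
        (graph_diameter T = 2 * r + 1 \<longrightarrow>
           lambda1 T \<ge> 4 * (sin (pi / (4 * real r + 6)))\<^sup>2 \<and>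
           4 * (sin (pi / (4 * real r + 6)))\<^sup>2 \<ge> 1 / (real r + 1)\<^sup>2)))
    \<and>
    (\<exists>C > 0. \<forall>r \<ge> 1.
      (\<exists>T :: nat pair_pre_digraph.
         undirected_tree T \<and> card (pverts T) \<ge> 3 \<and>
         inscribed_radius T = r \<and> graph_diameter T = 2 * r \<and>
         lambda1 T \<le> C * (4 * (sin (pi / (4 * real r + 2)))\<^sup>2) \<and>
         lambda1 T \<le> C * (1 / (real r)\<^sup>2)) \<and>
      (\<exists>T :: nat pair_pre_digraph.
         undirected_tree T \<and> card (pverts T) \<ge> 3 \<and>
         inscribed_radius T = r \<and> graph_diameter T = 2 * r + 1 \<and>
         lambda1 T \<le> C * (4 * (sin (pi / (4 * real r + 6)))\<^sup>2) \<and>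
         lambda1 T \<le> C * (1 / (real r + 1)\<^sup>2)))"
proof (intro conjI allI impI)
  fix T :: "'a pair_pre_digraph"
  assume T: "undirected_tree T \<and> 3 \<le> card (pverts T)"
  then interpret pair_graph T by (simp add: undirected_tree_def)
  have D: "0 < graph_diameter T"
    "4 * (sin (pi / (4 * real ((graph_diameter T + 1) div 2) + 2)))\<^sup>2 \<le> lambda1 T"
    using lambda1_ge_of_diameter T by auto
  define r where "r = inscribed_radius T"
  have "lambda1 T \<ge> 4 * (sin (pi / (4 * real r + 2)))\<^sup>2 \<and>
      4 * (sin (pi / (4 * real r + 2)))\<^sup>2 \<ge> 1 / (real r)\<^sup>2" if "graph_diameter T = 2 * r"
    using D inverse_square_le_four_sin_squared[of "real r"] that by simp
  \<comment> \<open>Half of \<open>2 * r + 1\<close> rounds up to \<open>r + 1\<close>, and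
    \<open>4 * (r + 1) + 2 = 4 * r + 6\<close>.\<close>
  moreover have "lambda1 T \<ge> 4 * (sin (pi / (4 * real r + 6)))\<^sup>2 \<and>
      4 * (sin (pi / (4 * real r + 6)))\<^sup>2 \<ge> 1 / (real r + 1)\<^sup>2" if "graph_diameter T = 2 * r + 1"
    using D inverse_square_le_four_sin_squared[of "real r + 1"] that by (simp add: algebra_simps)
  ultimately show "let r = inscribed_radius T in
        (graph_diameter T = 2 * r \<longrightarrow>
           lambda1 T \<ge> 4 * (sin (pi / (4 * real r + 2)))\<^sup>2 \<and>
           4 * (sin (pi / (4 * real r + 2)))\<^sup>2 \<ge> 1 / (real r)\<^sup>2) \<and>
        (graph_diameter T = 2 * r + 1 \<longrightarrow>
           lambda1 T \<ge> 4 * (sin (pi / (4 * real r + 6)))\<^sup>2 \<and>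
           4 * (sin (pi / (4 * real r + 6)))\<^sup>2 \<ge> 1 / (real r + 1)\<^sup>2)"
    unfolding r_def Let_def by blast
next
  show "\<exists>C > 0. \<forall>r \<ge> 1.
      (\<exists>T :: nat pair_pre_digraph.
         undirected_tree T \<and> card (pverts T) \<ge> 3 \<and>
         inscribed_radius T = r \<and> graph_diameter T = 2 * r \<and>
         lambda1 T \<le> C * (4 * (sin (pi / (4 * real r + 2)))\<^sup>2) \<and>
         lambda1 T \<le> C * (1 / (real r)\<^sup>2)) \<and>
      (\<exists>T :: nat pair_pre_digraph.
         undirected_tree T \<and> card (pverts T) \<ge> 3 \<and>
         inscribed_radius T = r \<and> graph_diameter T = 2 * r + 1 \<and>
         lambda1 T \<le> C * (4 * (sin (pi / (4 * real r + 6)))\<^sup>2) \<and>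
         lambda1 T \<le> C * (1 / (real r + 1)\<^sup>2))"
  proof (intro exI[of _ "16 :: real"] conjI allI impI)
    fix r :: nat assume r: "1 \<le> r"
    \<comment> \<open>The constant 16 comes from the path bound \<open>16 / m\<^sup>2\<close> with
      \<open>s \<le> m\<close>; since \<open>1 / s\<^sup>2\<close> is the smaller of the two lower
      bounds, the sine bound follows. It is applied with \<open>s = r\<close>,
      \<open>m = 2 * r\<close> and with \<open>s = r + 1\<close>,
      \<open>m = 2 * r + 1\<close>.\<close>
    have *: "lambda1 (path_graph m) \<le> 16 * (1 / s\<^sup>2) \<and>
        lambda1 (path_graph m) \<le> 16 * (4 * (sin (pi / (4 * s + 2)))\<^sup>2)"
      if "2 \<le> m" "1 \<le> s" "s \<le> real m" for m s
    proof -
      have "16 / (real m)\<^sup>2 \<le> 16 / s\<^sup>2"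
        using that by (intro divide_left_mono power_mono) auto
      then show ?thesis
        using lambda1_path_graph_le[OF that(1)] inverse_square_le_four_sin_squared[OF that(2)]
        by simp
    qed
    show "\<exists>T :: nat pair_pre_digraph.
         undirected_tree T \<and> card (pverts T) \<ge> 3 \<and>
         inscribed_radius T = r \<and> graph_diameter T = 2 * r \<and>
         lambda1 T \<le> 16 * (4 * (sin (pi / (4 * real r + 2)))\<^sup>2) \<and>
         lambda1 T \<le> 16 * (1 / (real r)\<^sup>2)"
      using r *[of "2 * r" "real r"] undirected_tree_path_graph
      by (intro exI[of _ "path_graph (2 * r)"])
        (simp add: inscribed_radius_path_graph graph_diameter_path_graph)
    show "\<exists>T :: nat pair_pre_digraph.
         undirected_tree T \<and> card (pverts T) \<ge> 3 \<and>
         inscribed_radius T = r \<and> graph_diameter T = 2 * r + 1 \<and>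
         lambda1 T \<le> 16 * (4 * (sin (pi / (4 * real r + 6)))\<^sup>2) \<and>
         lambda1 T \<le> 16 * (1 / (real r + 1)\<^sup>2)"
      using r *[of "2 * r + 1" "real r + 1"] undirected_tree_path_graph
      by (intro exI[of _ "path_graph (2 * r + 1)"])
        (simp add: inscribed_radius_path_graph graph_diameter_path_graph add.commute)
  qed simp
qed

end
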